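(* Let $\mu$ be a probability distribution on $\mathbb{N}$ such that $\sum_{n\ge 1} n\,\mu(n) < \infty$. Then for any initial configuration $X_0 \in \mathcal{S}$ and any $k\in\mathbb{Z}$ such that $X_0(k)<\infty$, the infinite-bin model $(X_n)_{n\ge 0}$ with reproduction law $\mu$ started from $X_0$ satisfies $X_\infty(k)<\infty$ almost surely.
   Context: $\mathbb{N}=\{1,2,\ldots\}$ and $\mathbb{Z}_+=\{0,1,2,\ldots\}$. The set of configurations is $$\mathcal{S}=\Big\{X:\mathbb{Z}\to\mathbb{Z}_+\cup\{\infty\}\ :\ \sup\{j\in\mathbb{Z}: X(j)\neq 0\}\in(-\infty,\infty)\Big\};$$ $X(j)$ is the number of balls in the bin at position $j$ (so a configuration has at least one ball, and bins far enough to the right are empty). For $X\in\mathcal{S}$ and $k\in\mathbb{N}$, let $B(X,k)=\sup\{j\in\mathbb{Z}:\sum_{i=j}^\infty X(i)\ge k\}$ (location of the $k$th rightmost ball), with $\sup\emptyset=-\infty$. For $\xi\in\mathbb{N}$ define $\Phi_\xi:\mathcal{S}\to\mathcal{S}$ by $\Phi_\xi(X)(j)=X(j)+\mathbf{1}_{\{j=B(X,\xi)+1\}}$ for all $j\in\mathbb{Z}$ if $B(X,\xi)>-\infty$, and $\Phi_\xi(X)=X$ otherwise. Given a probability distribution $\mu$ on $\mathbb{N}$ and $X_0\in\mathcal{S}$ (deterministic), the infinite-bin model (IBM) with reproduction law $\mu$ started from $X_0$ is the process defined by $X_{n+1}=\Phi_{\xi_{n+1}}(X_n)$, $n\ge 0$,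 where $(\xi_n)_{n\ge1}$ are i.i.d. with law $\mu$. Since $X_n(k)$ is non-decreasing in $n$, the limit $X_\infty(k)=\lim_{n\to\infty}X_n(k)\in\mathbb{Z}_+\cup\{\infty\}$ exists for every $k\in\mathbb{Z}$. *)

theory Defs
  imports "HOL-Probability.Probability"
begin

text \<open>
  Suprema of sets of integers are taken in \<^typ>\<open>ereal\<close>, so that the supremum of the empty set
  is \<open>-\<infinity>\<close> and unbounded sets have supremum \<open>\<infinity>\<close>.
\<close>

definition int_Sup :: "int set \<Rightarrow> ereal" where
  "int_Sup A = (SUP j\<in>A. ereal (real_of_int j))"

definition configs :: "(int \<Rightarrow> enat) set" where
  "configs = {X. -\<infinity> < int_Sup {j. X j \<noteq> 0} \<and> int_Sup {j. X j \<noteq> 0} < \<infinity>}"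

definition ball_pos :: "(int \<Rightarrow> enat) \<Rightarrow> nat \<Rightarrow> ereal" where
  "ball_pos X k = int_Sup {j. enat k \<le> (\<Sum>\<^sub>\<infinity>i\<in>{j..}. X i)}"

text \<open>
  The move is meant for \<open>\<xi> \<ge> 1\<close>. For \<open>\<xi> = 0\<close> the ball position is \<open>\<infinity>\<close> and the
  configuration is left unchanged.
\<close>

definition ibm_move :: "nat \<Rightarrow> (int \<Rightarrow> enat) \<Rightarrow> (int \<Rightarrow> enat)" where
  "ibm_move \<xi> X =
     (if ball_pos X \<xi> > -\<infinity>
      then (\<lambda>j. X j + (if ereal (real_of_int j) = ball_pos X \<xi> + 1 then 1 else 0))
      else X)"

text \<open>
  The trajectory driven by a sequence \<open>x\<^sub>1, x\<^sub>2, \<dots>\<close>; the value \<open>x 0\<close> is not used.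
\<close>

primrec ibm :: "(int \<Rightarrow> enat) \<Rightarrow> (nat \<Rightarrow> nat) \<Rightarrow> nat \<Rightarrow> (int \<Rightarrow> enat)" where
  "ibm X0 x 0 = X0"
| "ibm X0 x (Suc n) = ibm_move (x (Suc n)) (ibm X0 x n)"

definition ibm_limit :: "(int \<Rightarrow> enat) \<Rightarrow> (nat \<Rightarrow> nat) \<Rightarrow> (int \<Rightarrow> enat)" where
  "ibm_limit X0 x k = lim (\<lambda>n. ibm X0 x n k)"

end

theory Submission
  imports Defs
begin

text \<open>
  Everything is read off from the number \<open>N\<^sub>n\<close> of balls in the half-line \<open>{k..}\<close> after \<open>n\<close> moves.
  A move \<open>\<xi> \<ge> 1\<close> with \<open>\<xi> \<le> N\<^sub>n\<close> duplicates a ball that lies at \<open>k\<close> or further to the right, so it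
  increases \<open>N\<^sub>n\<close> by one (\<open>balls_from_ibm_move_Suc\<close>) and puts nothing into bin \<open>k\<close>
  (\<open>ibm_move_bin_unchanged\<close>). Hence bin \<open>k\<close> can only receive a ball at a step with
  \<open>\<xi>\<^sub>n\<^sub>+\<^sub>1 > N\<^sub>n\<close>.

  Fix a value \<open>m\<close> that \<open>\<mu>\<close> charges. If \<open>N\<^sub>n\<close> stays below \<open>m\<close> for ever, the content of bin \<open>k\<close> does so
  as well. Otherwise, from the first time at which \<open>N\<^sub>n \<ge> m\<close>, every step with \<open>\<xi> = m\<close>
  increases \<open>N\<^sub>n\<close>, so that up to an additive constant \<open>N\<^sub>n\<close> is at least the number of occurrences of \<open>m\<close>
  among \<open>\<xi>\<^sub>1, \<dots>, \<xi>\<^sub>n\<close>. By Hoeffding's inequality and Borel-Cantelli that number is almost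
  surely at least \<open>n \<mu>(m) / 2\<close> for all large \<open>n\<close> (\<open>AE_eventually_occurrences_ge\<close>). On the other hand
  the mean of \<open>\<mu>\<close> is finite, so for every \<open>c > 0\<close> the sum over \<open>n\<close> of the probabilities of
  \<open>\<xi>\<^sub>n\<^sub>+\<^sub>1 > c n\<close> is finite, and almost surely \<open>\<xi>\<^sub>n\<^sub>+\<^sub>1 \<le> c n\<close> for all large \<open>n\<close>
  (\<open>AE_eventually_dilated_le\<close>). With \<open>c = \<mu>(m) / 4\<close> the two bounds give
  \<open>\<xi>\<^sub>n\<^sub>+\<^sub>1 \<le> N\<^sub>n\<close> for all large \<open>n\<close>, so bin \<open>k\<close> receives only finitely many balls.
\<close>

section \<open>Counting the balls in a half-line\<close>

abbreviation balls_from :: "(int \<Rightarrow> enat) \<Rightarrow> int \<Rightarrow> enat" where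
  "balls_from X k \<equiv> (\<Sum>\<^sub>\<infinity>i\<in>{k..}. X i)"

lemma bin_le_balls_from: "X k \<le> balls_from X k"
proof -
  have "infsum X {k} \<le> balls_from X k"
    by (rule infsum_mono_neutral) auto
  then show ?thesis by simp
qed

lemma ibm_move_ge: "X j \<le> ibm_move m X j"
  by (simp add: ibm_move_def)

lemma balls_from_ibm_move_ge: "balls_from X k \<le> balls_from (ibm_move m X) k"
  by (rule infsum_mono) (auto simp: ibm_move_ge)

text \<open>
  Right-boundedness is the part of membership in \<^const>\<open>configs\<close> that keeps the positions
  of the balls below \<open>\<infinity>\<close>, and it is what has to be carried along a trajectory.
\<close>

lemma bounded_right_ibm_move:
  assumes "\<exists>J. \<forall>j>J. X j = 0"
  shows "\<exists>J. \<forall>j>J. ibm_move m X j = 0"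
proof (cases "\<exists>j. ereal (real_of_int j) = ball_pos X m + 1")
  case False
  with assms show ?thesis by (auto simp: ibm_move_def)
next
  case True
  then obtain j1 where j1: "ereal (real_of_int j1) = ball_pos X m + 1" by auto
  from assms obtain J where "\<forall>j>J. X j = 0" by auto
  then have "\<forall>j>max J j1. ibm_move m X j = 0"
    by (auto simp: ibm_move_def simp flip: j1)
  then show ?thesis ..
qed

lemma configs_bounded_right:
  assumes "X \<in> configs"
  shows "\<exists>J. \<forall>j>J. X j = 0"
proof -
  have "int_Sup {j. X j \<noteq> 0} < \<infinity>"
    using assms by (simp add: configs_def)
  then obtain r where r: "int_Sup {j. X j \<noteq> 0} < ereal r"
    using ereal_dense2[of "int_Sup {j. X j \<noteq> 0}" \<infinity>] by (auto simp: less_ereal.simps)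
  have "j \<le> \<lceil>r\<rceil>" if "X j \<noteq> 0" for j
  proof -
    have "ereal (real_of_int j) \<le> int_Sup {j. X j \<noteq> 0}"
      unfolding int_Sup_def by (rule SUP_upper) (use that in auto)
    also note r
    finally show ?thesis by (simp add: le_ceiling_iff) 
  qed
  then show ?thesis by (intro exI[of _ "\<lceil>r\<rceil>"]) force
qed

text \<open>
  Suprema are taken among the extended reals, but \<^const>\<open>ibm_move\<close> adds a ball only when the position
  following the supremum is an integer. A non-empty set of integers that is bounded above has a maximum,
  and cutting it off below at one of its points makes it finite.
\<close>

lemma int_Sup_attained:
  assumes "j0 \<in> A" and "\<And>j. j \<in> A \<Longrightarrow> j \<le> J"
  shows "\<exists>j\<in>A. j0 \<le> j \<and> int_Sup A = ereal (real_of_int j)"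
proof -
  have fin: "finite (A \<inter> {j0..})"
    by (rule finite_subset[of _ "{j0..J}"]) (use assms in auto)
  define j where "j = Max (A \<inter> {j0..})"
  have j: "j \<in> A \<inter> {j0..}"
    unfolding j_def using fin assms(1) by (intro Max_in) auto
  have upper: "i \<le> j" if "i \<in> A" for i
  proof (cases "j0 \<le> i")
    case True
    then show ?thesis using that fin unfolding j_def by (intro Max_ge) auto
  next
    case False
    then show ?thesis using j by auto
  qed
  have "int_Sup A = ereal (real_of_int j)"
    unfolding int_Sup_def using j upper by (intro SUP_eqI) auto
  then show ?thesis using j by auto
qed

text \<open>
  If the half-line contains the \<open>m\<close>-th rightmost ball, then the new ball lands one bin to the right of
  that ball and thus also in the half-line. The case \<open>m = 0\<close> is different: its ball position is \<open>\<infinity>\<close>.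
\<close>

lemma balls_from_ibm_move_Suc:
  assumes bounded: "\<exists>J. \<forall>j>J. X j = 0"
    and m: "1 \<le> m" "enat m \<le> balls_from X k"
  shows "balls_from X k + 1 \<le> balls_from (ibm_move m X) k"
proof -
  define A where "A = {j. enat m \<le> balls_from X j}"
  obtain J where J: "\<forall>j>J. X j = 0" using bounded by auto
  have "j \<le> J" if "j \<in> A" for j
  proof (rule ccontr)
    assume "\<not> j \<le> J"
    then have "balls_from X j = 0" using J by (intro infsum_0) auto
    then show False using that m(1) by (auto simp: A_def zero_enat_def)
  qed
  then obtain b where b: "k \<le> b" "ball_pos X m = ereal (real_of_int b)"
    using int_Sup_attained[of k A J] m(2) by (auto simp: A_def ball_pos_def)
  define e :: "int \<Rightarrow> enat" where "e = (\<lambda>j. if j = b + 1 then 1 else 0)"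
  have eq: "(ereal (real_of_int j) = ereal (real_of_int b) + 1) = (j = b + 1)" for j
    by (auto simp: one_ereal_def)
  have move: "ibm_move m X = (\<lambda>j. X j + e j)"
    by (auto simp: ibm_move_def b(2) e_def eq)
  have "1 \<le> balls_from e k"
  proof -
    have "infsum e {b + 1} \<le> balls_from e k"
      by (rule infsum_mono_neutral) (use b in auto)
    then show ?thesis by (simp add: e_def)
  qed
  moreover have "balls_from (\<lambda>j. X j + e j) k = balls_from X k + balls_from e k"
    by (rule infsum_add) auto
  ultimately show ?thesis unfolding move by (simp add: add_left_mono)
qed

text \<open>
  If at least \<open>m\<close> balls lie at \<open>k\<close> or further right, then so does the duplicated ball, and
  its copy falls strictly to the right of \<open>k\<close>.
\<close>

lemma ibm_move_bin_unchanged: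
  assumes "enat m \<le> balls_from X k"
  shows "ibm_move m X k = X k"
proof -
  have "ereal (real_of_int k) \<le> ball_pos X m"
    unfolding ball_pos_def int_Sup_def by (rule SUP_upper) (use assms in auto)
  then have "ereal (real_of_int k) \<noteq> ball_pos X m + 1"
    by (cases "ball_pos X m") (auto simp: one_ereal_def)
  then show ?thesis by (simp add: ibm_move_def)
qed

section \<open>Trajectories\<close>

lemma incseq_ibm: "incseq (\<lambda>n. ibm X0 x n k)"
  by (rule incseq_SucI) (simp add: ibm_move_ge)

lemma incseq_balls_from_ibm: "incseq (\<lambda>n. balls_from (ibm X0 x n) k)"
  by (rule incseq_SucI) (simp add: balls_from_ibm_move_ge)

lemma bounded_right_ibm:
  assumes "X0 \<in> configs"
  shows "\<exists>J. \<forall>j>J. ibm X0 x n j = 0"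
  by (induction n) (use assms configs_bounded_right bounded_right_ibm_move in auto)

lemma ibm_limit_finite:
  assumes "\<And>n. ibm X0 x n k \<le> C" and "C < \<infinity>"
  shows "ibm_limit X0 x k < \<infinity>"
proof -
  have "(\<lambda>n. ibm X0 x n k) \<longlonglongrightarrow> (SUP n. ibm X0 x n k)"
    by (rule LIMSEQ_SUP[OF incseq_ibm])
  then have "ibm_limit X0 x k = (SUP n. ibm X0 x n k)"
    unfolding ibm_limit_def by (rule limI)
  also have "\<dots> \<le> C" by (rule SUP_least) (rule assms)
  finally show ?thesis using assms(2) by (rule le_less_trans)
qed

definition occurrences :: "(nat \<Rightarrow> nat) \<Rightarrow> nat \<Rightarrow> nat \<Rightarrow> nat" where
  "occurrences x m n = card {i \<in> {1..n}. x i = m}"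

lemma occurrences_Suc:
  "occurrences x m (Suc n) = occurrences x m n + (if x (Suc n) = m then 1 else 0)"
proof -
  have "{i \<in> {1..Suc n}. x i = m} =
        (if x (Suc n) = m then insert (Suc n) {i \<in> {1..n}. x i = m} else {i \<in> {1..n}. x i = m})"
    by (auto simp: le_Suc_eq)
  then show ?thesis by (simp add: occurrences_def)
qed

text \<open>
  Once the half-line holds \<open>m\<close> balls it keeps them, so each later move \<open>m\<close> adds one. The
  bound is stated additively because subtraction of extended naturals truncates. It only
  uses the moves equal to \<open>m\<close>, which makes the lower bound independent of the configuration.
\<close>

lemma occurrences_le_balls_from:
  assumes X0: "X0 \<in> configs" and m: "1 \<le> m"
    and start: "enat m \<le> balls_from (ibm X0 x n0) k" and "n0 \<le> n"
  shows "enat (occurrences x m n) \<le> balls_from (ibm X0 x n) k + enat (occurrences x m n0)"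
  using \<open>n0 \<le> n\<close>
proof (induction n rule: dec_induct)
  case base
  show ?case by simp
next
  case (step n)
  have reached: "enat m \<le> balls_from (ibm X0 x n) k"
    using start incseqD[OF incseq_balls_from_ibm step.hyps(1)] by (rule order_trans)
  show ?case
  proof (cases "x (Suc n) = m")
    case True
    have "enat (occurrences x m (Suc n)) = enat (occurrences x m n) + 1"
      using True by (simp add: occurrences_Suc one_enat_def)
    also have "\<dots> \<le> (balls_from (ibm X0 x n) k + 1) + enat (occurrences x m n0)"
      using add_right_mono[OF step.IH, of 1] by (simp add: ac_simps)
    also have "balls_from (ibm X0 x n) k + 1 \<le> balls_from (ibm X0 x (Suc n)) k"
      using balls_from_ibm_move_Suc[OF bounded_right_ibm[OF X0] m reached] True by simp
    finally show ?thesis by (simp add: add_right_mono)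
  next
    case False
    have "enat (occurrences x m (Suc n)) = enat (occurrences x m n)"
      using False by (simp add: occurrences_Suc)
    also note step.IH
    also have "balls_from (ibm X0 x n) k \<le> balls_from (ibm X0 x (Suc n)) k"
      by (simp add: balls_from_ibm_move_ge)
    finally show ?thesis by (simp add: add_right_mono)
  qed
qed

text \<open>
  The deterministic core. The hypothesis is required for every \<open>d\<close> because it is applied with \<open>d\<close> the
  number of occurrences of \<open>m\<close> before the half-line first contains \<open>m\<close> balls, a time that depends on
  the trajectory.
\<close>

lemma ibm_limit_finite_if_frequent:
  assumes X0: "X0 \<in> configs" and k: "X0 k < \<infinity>" and m: "1 \<le> m"
    and small: "\<And>d. \<forall>\<^sub>F n in sequentially. x (Suc n) + d \<le> occurrences x m n"
  shows "ibm_limit X0 x k < \<infinity>"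
proof (cases "\<exists>n0. enat m \<le> balls_from (ibm X0 x n0) k")
  case False
  have "ibm X0 x n k \<le> enat m" for n
    using bin_le_balls_from[of "ibm X0 x n" k] False by (meson le_cases order_trans)
  then show ?thesis by (rule ibm_limit_finite) simp
next
  case True
  then obtain n0 where n0: "enat m \<le> balls_from (ibm X0 x n0) k" by auto
  obtain n1 where n1: "\<And>n. n \<ge> n1 \<Longrightarrow> x (Suc n) + occurrences x m n0 \<le> occurrences x m n"
    using small[of "occurrences x m n0"] by (auto simp: eventually_sequentially)
  \<comment> \<open>From step \<open>n2\<close> on every move selects a ball of the half-line, so bin \<open>k\<close> no longer changes.\<close>
  define n2 where "n2 = max n0 n1"
  have unchanged: "ibm X0 x (Suc n) k = ibm X0 x n k" if "n \<ge> n2" for n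
  proof -
    have "enat (x (Suc n)) + enat (occurrences x m n0) \<le> enat (occurrences x m n)"
      using n1[of n] that by (simp add: n2_def)
    also have "\<dots> \<le> balls_from (ibm X0 x n) k + enat (occurrences x m n0)"
      using that by (intro occurrences_le_balls_from X0 m n0) (simp add: n2_def)
    finally have "enat (x (Suc n)) \<le> balls_from (ibm X0 x n) k"
      by (cases "balls_from (ibm X0 x n) k") auto
    then show ?thesis by (simp add: ibm_move_bin_unchanged)
  qed
  have const: "ibm X0 x n k = ibm X0 x n2 k" if "n \<ge> n2" for n
    using that by (induction n rule: dec_induct) (use unchanged in auto)
  have "ibm X0 x n k \<le> ibm X0 x n2 k" for n
    by (metis const incseq_ibm incseqD nat_le_linear order_refl)
  moreover have "ibm X0 x n k < \<infinity>" for n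
  proof (induction n)
    case 0
    show ?case using k by simp
  next
    case (Suc n)
    then show ?case by (auto simp: ibm_move_def one_enat_def plus_enat_def split: enat.splits)
  qed
  ultimately show ?thesis by (rule ibm_limit_finite)
qed

section \<open>Almost sure behaviour of the driving sequence\<close>

lemma measure_pmf_nat_mean_finite:
  assumes "(\<lambda>n. real n * pmf \<mu> n) summable_on {1..}"
  shows "(\<integral>\<^sup>+n. of_nat n \<partial>measure_pmf \<mu>) < \<infinity>"
proof -
  have "(\<lambda>n. real n * pmf \<mu> n) summable_on UNIV"
    using assms by (rule summable_on_cong_neutral[THEN iffD1, rotated -1]) auto
  then have "summable (\<lambda>n. real n * pmf \<mu> n)"
    by (simp add: summable_on_UNIV_nonneg_real_iff)
  moreover have "(\<integral>\<^sup>+n. of_nat n \<partial>measure_pmf \<mu>) = (\<Sum>n. ennreal (real n * pmf \<mu> n))"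
    by (simp add: nn_integral_measure_pmf nn_integral_count_space_nat ennreal_mult
        ennreal_of_nat_eq_real_of_nat mult.commute)
  ultimately show ?thesis by (simp add: suminf_ennreal2)
qed

context prob_space
begin

text \<open>
  The probabilities of the exceptional events \<open>n < q \<xi>\<^sub>n\<^sub>+\<^sub>1\<close> are the tail probabilities of \<open>q\<close> times a
  variable with law \<open>\<mu>\<close>, hence they add up to \<open>q\<close> times the mean of \<open>\<mu>\<close>, and Borel-Cantelli applies.
\<close>

lemma AE_eventually_dilated_le:
  fixes \<xi> :: "nat \<Rightarrow> 'a \<Rightarrow> nat" and \<mu> :: "nat pmf"
  assumes meas: "\<And>n. n \<ge> 1 \<Longrightarrow> \<xi> n \<in> measurable M (count_space UNIV)"
    and distr: "\<And>n. n \<ge> 1 \<Longrightarrow> distr M (count_space UNIV) (\<xi> n) = measure_pmf \<mu>"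
    and mean: "(\<integral>\<^sup>+n. of_nat n \<partial>measure_pmf \<mu>) < \<infinity>"
  shows "AE \<omega> in M. \<forall>\<^sub>F n in sequentially. q * \<xi> (Suc n) \<omega> \<le> n"
proof -
  define A where "A n = {\<omega> \<in> space M. n < q * \<xi> (Suc n) \<omega>}" for n
  have [measurable]: "\<xi> (Suc n) \<in> measurable M (count_space UNIV)" for n
    by (rule meas) simp
  have A [measurable]: "A n \<in> sets M" for n
    unfolding A_def by measurable
  have "emeasure M (A n) = emeasure (measure_pmf \<mu>) {i. n < q * i}" for n
  proof -
    have "emeasure (measure_pmf \<mu>) {i. n < q * i} =
          emeasure (distr M (count_space UNIV) (\<xi> (Suc n))) {i. n < q * i}"
      by (simp add: distr)
    also have "\<dots> = emeasure M (A n)"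
      by (subst emeasure_distr) (auto simp: A_def intro!: arg_cong[where f = "emeasure M"])
    finally show ?thesis ..
  qed
  then have "(\<Sum>n. emeasure M (A n)) = (\<integral>\<^sup>+i. of_nat (q * i) \<partial>measure_pmf \<mu>)"
    by (subst nn_integral_nat_function) auto
  also have "\<dots> = of_nat q * (\<integral>\<^sup>+i. of_nat i \<partial>measure_pmf \<mu>)"
    by (simp add: nn_integral_cmult)
  also have "\<dots> < \<infinity>"
    using mean by (simp add: ennreal_mult_less_top of_nat_less_top)
  finally have "summable (\<lambda>n. measure M (A n))"
    by (intro summable_suminf_not_top) (auto simp: emeasure_eq_measure)
  then have "AE \<omega> in M. \<forall>\<^sub>F n in sequentially. \<omega> \<in> space M - A n"
    by (intro borel_cantelli_AE1) (auto simp: emeasure_eq_measure)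
  then show ?thesis
    by (rule AE_mp) (auto simp: A_def elim!: eventually_mono)
qed

text \<open>
  A one-sided substitute for the strong law of large numbers: the number of occurrences is a sum of \<open>n\<close>
  independent indicators of mean \<open>p = \<mu>(m)\<close>, and Hoeffding's inequality bounds the probability that it
  falls short of its mean by \<open>n p / 2\<close> by \<open>exp (- p\<^sup>2 / 2) ^ n\<close>, which is summable.
\<close>

lemma AE_eventually_occurrences_ge:
  fixes \<xi> :: "nat \<Rightarrow> 'a \<Rightarrow> nat" and \<mu> :: "nat pmf"
  assumes indep: "indep_vars (\<lambda>_. count_space UNIV) \<xi> {1..}"
    and distr: "\<And>n. n \<ge> 1 \<Longrightarrow> distr M (count_space UNIV) (\<xi> n) = measure_pmf \<mu>"
    and m: "m \<in> set_pmf \<mu>"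
  shows "AE \<omega> in M. \<forall>\<^sub>F n in sequentially.
           real n * pmf \<mu> m / 2 \<le> real (occurrences (\<lambda>i. \<xi> i \<omega>) m n)"
proof -
  define p where "p = pmf \<mu> m"
  have p: "p > 0" using m by (simp add: p_def pmf_positive)
  define Y where "Y i \<omega> = indicat_real {m} (\<xi> i \<omega>)" for i \<omega>
  have meas [measurable]: "\<xi> i \<in> measurable M (count_space UNIV)" if "i \<ge> 1" for i
    using indep that by (auto simp: indep_vars_def)
  have occ: "(\<Sum>i\<in>{1..n}. Y i \<omega>) = real (occurrences (\<lambda>i. \<xi> i \<omega>) m n)" for n \<omega>
    by (simp add: Y_def indicator_def sum.If_cases Int_def occurrences_def)
  have expY: "expectation (Y i) = p" if "i \<ge> 1" for i
  proof -
    have "expectation (Y i) = (\<integral>j. indicat_real {m} j \<partial>distr M (count_space UNIV) (\<xi> i))"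
      unfolding Y_def using meas[OF that] by (subst integral_distr) auto
    also have "\<dots> = p"
      using that by (simp add: distr p_def pmf.rep_eq)
    finally show ?thesis .
  qed
  \<comment> \<open>The threshold is \<open>n p / 2\<close>, written as mean minus deviation to match Hoeffding's inequality.\<close>
  define A where "A n = {\<omega> \<in> space M. (\<Sum>i\<in>{1..n}. Y i \<omega>) \<le> real n * p - real n * p / 2}" for n
  have indepY: "indep_vars (\<lambda>_. borel) Y {1..n}" for n
    unfolding Y_def
    by (rule indep_vars_compose2[OF indep_vars_subset[OF indep]]) auto
  have Ymeas [measurable]: "Y i \<in> borel_measurable M" if "i \<ge> 1" for i
    using indepY[of i] that by (auto simp: indep_vars_def)
  have A [measurable]: "A n \<in> sets M" for n
  proof -
    have "(\<lambda>\<omega>. \<Sum>i\<in>{1..n}. Y i \<omega>) \<in> borel_measurable M"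
      by (rule borel_measurable_sum) (auto intro: Ymeas)
    then show ?thesis unfolding A_def by measurable
  qed
  have bound: "prob (A n) \<le> exp (- p\<^sup>2 / 2) ^ n" if "n \<ge> 1" for n
  proof -
    interpret Hoeffding_ineq M "{1..n}" Y "\<lambda>_. 0" "\<lambda>_. 1" "\<Sum>i\<in>{1..n}. expectation (Y i)"
    proof unfold_locales
      show "indep_vars (\<lambda>_. borel) Y {1..n}" by (rule indepY)
      show "AE \<omega> in M. Y i \<omega> \<in> {0..1}" for i
        by (rule AE_I2) (simp add: Y_def indicator_def)
    qed simp_all
    have "(\<Sum>i\<in>{1..n}. expectation (Y i)) = real n * p"
      by (simp add: expY)
    then have "prob (A n) \<le> exp (- 2 * (real n * p / 2)\<^sup>2 / (\<Sum>i\<in>{1..n}. (1 - 0)\<^sup>2))"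
      using Hoeffding_ineq_le[of "real n * p / 2"] that p by (simp add: A_def)
    also have "- 2 * (real n * p / 2)\<^sup>2 / (\<Sum>i\<in>{1..n}. (1 - 0)\<^sup>2) = real n * (- p\<^sup>2 / 2)"
      using that by (simp add: power2_eq_square field_simps)
    finally show ?thesis by (simp only: exp_of_nat_mult)
  qed
  have "summable (\<lambda>n. exp (- p\<^sup>2 / 2) ^ n)"
    using p by (intro summable_geometric) simp
  then have "summable (\<lambda>n. prob (A n))"
    by (rule summable_comparison_test'[where N = 1]) (use bound in auto)
  then have "AE \<omega> in M. \<forall>\<^sub>F n in sequentially. \<omega> \<in> space M - A n"
    by (intro borel_cantelli_AE1) (auto simp: emeasure_eq_measure)
  then show ?thesis
  proof (rule AE_mp, intro AE_I2 impI)
    fix \<omega> assume "\<forall>\<^sub>F n in sequentially. \<omega> \<in> space M - A n"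
    then show "\<forall>\<^sub>F n in sequentially.
        real n * pmf \<mu> m / 2 \<le> real (occurrences (\<lambda>i. \<xi> i \<omega>) m n)"
      unfolding A_def p_def occ by (rule eventually_mono) auto
  qed
qed

text \<open>
  The lower bound \<open>n p / 2\<close> on the occurrences is split into halves: \<open>n p / 4\<close> absorbs the next
  move and \<open>n p / 4\<close> absorbs the constant \<open>d\<close>.
\<close>

lemma AE_eventually_add_le_occurrences:
  fixes \<xi> :: "nat \<Rightarrow> 'a \<Rightarrow> nat" and \<mu> :: "nat pmf"
  assumes indep: "indep_vars (\<lambda>_. count_space UNIV) \<xi> {1..}"
    and distr: "\<And>n. n \<ge> 1 \<Longrightarrow> distr M (count_space UNIV) (\<xi> n) = measure_pmf \<mu>"
    and mean: "(\<integral>\<^sup>+n. of_nat n \<partial>measure_pmf \<mu>) < \<infinity>"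
    and m: "m \<in> set_pmf \<mu>"
  shows "AE \<omega> in M. \<forall>d. \<forall>\<^sub>F n in sequentially.
           \<xi> (Suc n) \<omega> + d \<le> occurrences (\<lambda>i. \<xi> i \<omega>) m n"
proof -
  define p where "p = pmf \<mu> m"
  have p: "p > 0" using m by (simp add: p_def pmf_positive)
  obtain q :: nat where q: "4 / p \<le> real q" using real_arch_simple by blast
  have meas: "\<xi> n \<in> measurable M (count_space UNIV)" if "n \<ge> 1" for n
    using indep that by (auto simp: indep_vars_def)
  have "AE \<omega> in M. \<forall>\<^sub>F n in sequentially. q * \<xi> (Suc n) \<omega> \<le> n"
    by (rule AE_eventually_dilated_le[OF meas distr mean])
  moreover have "AE \<omega> in M. \<forall>\<^sub>F n in sequentially.
           real n * p / 2 \<le> real (occurrences (\<lambda>i. \<xi> i \<omega>) m n)"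
    unfolding p_def by (rule AE_eventually_occurrences_ge[OF indep distr m])
  ultimately show ?thesis
  proof (eventually_elim, intro allI)
    fix \<omega> d
    assume le: "\<forall>\<^sub>F n in sequentially. q * \<xi> (Suc n) \<omega> \<le> n"
      and ge: "\<forall>\<^sub>F n in sequentially. real n * p / 2 \<le> real (occurrences (\<lambda>i. \<xi> i \<omega>) m n)"
    obtain N :: nat where N: "real d * 4 / p \<le> real N" using real_arch_simple by blast
    show "\<forall>\<^sub>F n in sequentially. \<xi> (Suc n) \<omega> + d \<le> occurrences (\<lambda>i. \<xi> i \<omega>) m n"
      using le ge eventually_ge_at_top[of N]
    proof eventually_elim
      case (elim n)
      have "4 / p * real (\<xi> (Suc n) \<omega>) \<le> real q * real (\<xi> (Suc n) \<omega>)"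
        by (rule mult_right_mono[OF q]) simp
      also have "\<dots> \<le> real n"
        using elim(1) by (simp flip: of_nat_mult)
      finally have "real (\<xi> (Suc n) \<omega>) \<le> real n * p / 4"
        using p by (simp add: field_simps)
      moreover have "real d \<le> real n * p / 4"
      proof -
        have "real d * 4 / p \<le> real n" using N elim(3) by linarith
        then show ?thesis using p by (simp add: field_simps)
      qed
      ultimately have "real (\<xi> (Suc n) \<omega> + d) \<le> real (occurrences (\<lambda>i. \<xi> i \<omega>) m n)"
        using elim(2) by simp
      then show ?case by (simp only: of_nat_le_iff)
    qed
  qed
qed

end

section \<open>Finiteness of the limit\<close>

theorem proposition1p1:
  fixes \<mu> :: "nat pmf"
    and M :: "'a measure"
    and \<xi> :: "nat \<Rightarrow> 'a \<Rightarrow> nat"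
    and X0 :: "int \<Rightarrow> enat"
    and k :: int
  assumes "set_pmf \<mu> \<subseteq> {1..}"
    and "(\<lambda>n. real n * pmf \<mu> n) summable_on {1..}"
    and "prob_space M"
    and "prob_space.indep_vars M (\<lambda>_. count_space UNIV) \<xi> {1..}"
    and "\<And>n. n \<ge> 1 \<Longrightarrow> distr M (count_space UNIV) (\<xi> n) = measure_pmf \<mu>"
    and "X0 \<in> configs"
    and "X0 k < \<infinity>"
  shows "AE \<omega> in M. ibm_limit X0 (\<lambda>n. \<xi> n \<omega>) k < \<infinity>"
proof -
  interpret prob_space M by fact
  obtain m where m: "m \<in> set_pmf \<mu>" using set_pmf_not_empty[of \<mu>] by blast
  then have "1 \<le> m" using assms(1) by auto
  have "AE \<omega> in M. \<forall>d. \<forall>\<^sub>F n in sequentially.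
           \<xi> (Suc n) \<omega> + d \<le> occurrences (\<lambda>i. \<xi> i \<omega>) m n"
    by (rule AE_eventually_add_le_occurrences[OF assms(4,5)
          measure_pmf_nat_mean_finite[OF assms(2)] m])
  then show ?thesis
    by eventually_elim (rule ibm_limit_finite_if_frequent[OF assms(6,7) \<open>1 \<le> m\<close>], blast)
qed

end
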